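(* Let $\mathcal{X}=[0,1]^m$, let $\mathcal{A}$ be a nonempty compact action space, and let $U^{\mathrm{A}},U^{\mathrm{P}}:\mathcal{X}\times\mathcal{A}\to\mathbb{R}$ be continuous. Let $\delta:\mathcal{A}\to\mathbb{R}^n$ be continuous and one-to-one (i.e. $\delta(a_1)\neq\delta(a_2)$ whenever $a_1\neq a_2$), and let $w$ be an $\mathbb{R}^n$-valued random variable whose distribution is absolutely continuous with respect to Lebesgue measure (in particular, $\mathbb{P}[\langle v_1,w\rangle=v_2]=0$ for all $v_1\in\mathbb{R}^n\setminus\{0\}$, $v_2\in\mathbb{R}$). Define $$\tilde a^\star(x,w)=\arg\max_{a\in\mathcal{A}}\left\{U^{\mathrm{A}}(x,a)+\langle w,\delta(a)\rangle\right\},\qquad \tilde U^{\mathrm{PA}}(x)=\mathbb{E}_w\left[U^{\mathrm{P}}(x,\tilde a^\star(x,w))\right].$$ Then: (i) The best response is a singleton and continuous at any $x\in\mathcal{X}$ almost surely: for every $x\in\mathcal{X}$ and every sequence $x_j\to x$ in $\mathcal{X}$, $$\mathbb{P}\left[\,w:\ \tilde a^\star(x,w)\text{ is a singleton and, for all } a_j\in\tilde a^\star(x_j,w),\ \lim_{j\to\infty}a_j=\tilde a^\star(x,w)\right]=1.$$ (ii) The function $\tilde U^{\mathrm{PA}}$ is continuous on $\mathcal{X}$.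
   Context: $\mathcal{X}=[0,1]^m$ is the set of contracts, $\mathcal{A}$ is the agent's action set, $U^{\mathrm{A}}$ is the agent's utility and $U^{\mathrm{P}}$ the principal's (uncoupled) utility. The set $\tilde a^\star(x,w)\subseteq\mathcal{A}$ is the (a priori set-valued) set of maximizers, i.e. the agent's best response to contract $x$ given the realization of $w$; when it is a singleton it is identified with its unique element. In the definition of $\tilde U^{\mathrm{PA}}$, the value $U^{\mathrm{P}}(x,\tilde a^\star(x,w))$ is understood for those $w$ (almost all, by (i)) for which $\tilde a^\star(x,w)$ is a singleton. $\langle\cdot,\cdot\rangle$ is the Euclidean inner product. *)

theory Defs
  imports "HOL-Probability.Probability"
begin

definition best_response ::
  "('x \<times> 'a \<Rightarrow> real) \<Rightarrow> 'a set \<Rightarrow> ('a \<Rightarrow> real ^ 'n) \<Rightarrow> 'x \<Rightarrow> real ^ 'n \<Rightarrow> 'a set" where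
  "best_response UA A \<delta> x v = {a. is_arg_max (\<lambda>a. UA (x, a) + v \<bullet> \<delta> a) (\<lambda>a. a \<in> A) a}"

text \<open>The expectation ranges over those outcomes for which the best response is a singleton,
  identified with its element; the remaining outcomes, where the principal's utility has no
  meaning, contribute nothing.\<close>

definition principal_utility ::
  "'w measure \<Rightarrow> ('w \<Rightarrow> real ^ 'n) \<Rightarrow> ('x \<times> 'a \<Rightarrow> real) \<Rightarrow> ('x \<times> 'a \<Rightarrow> real) \<Rightarrow> 'a set
    \<Rightarrow> ('a \<Rightarrow> real ^ 'n) \<Rightarrow> 'x \<Rightarrow> real" where
  "principal_utility M w UP UA A \<delta> x =
    (LINT \<omega>:{\<omega> \<in> space M. is_singleton (best_response UA A \<delta> x (w \<omega>))}|M.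
      UP (x, the_elem (best_response UA A \<delta> x (w \<omega>))))"

end

theory Submission
  imports Defs
begin

text \<open>
  Compactness makes the maximizer correspondence upper hemicontinuous in all parameters, so
  maximizers converge wherever the limiting maximizer is unique; everything reduces to showing that
  ties are negligible. By injectivity of \<open>\<delta>\<close>, a tie at \<open>v\<close> yields maximizers \<open>a, a'\<close> and a
  coordinate \<open>i\<close> with \<open>\<delta> a $ i \<le> q < r \<le> \<delta> a' $ i\<close> for some rational \<open>q, r\<close>. For fixed \<open>i, q, r\<close>
  these \<open>v\<close> form a closed set, and since the maximizers are monotone in direction \<open>i\<close>, that set
  meets each line in this direction at most once. Its translates along the direction are therefore
  disjoint, so it is a null set. Continuity of the expected utility is dominated convergence.
\<close>

section \<open>Null sets by disjoint translates\<close>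

text \<open>Cut \<open>S\<close> down to a ball. Infinitely many shifts of the piece along
  \<open>b\<close> are disjoint, have equal measure and fit into one larger ball of finite measure,
  so the common measure is 0. Closedness makes the pieces and their shifts compact, hence
  Borel.\<close>

lemma closed_null_set_if_one_point_per_line:
  fixes S :: "'a::euclidean_space set"
  assumes "closed S" and line: "\<And>x t. x \<in> S \<Longrightarrow> 0 < t \<Longrightarrow> x + t *\<^sub>R b \<notin> S"
  shows "S \<in> null_sets lborel"
proof -
  have bounded_part: "S \<inter> cball 0 (real k) \<in> null_sets lborel" for k
  proof -
    let ?S = "S \<inter> cball 0 (real k)"
    \<comment> \<open>The coefficients strictly decrease, so a point common to two translates gives
      two points of \<open>S\<close> that differ by a positive multiple of \<open>b\<close>. They
      are at most 1, which keeps every translate within radius \<open>k + norm b\<close>.\<close>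
    define c where "c j = (1 / real (Suc j)) *\<^sub>R b" for j
    define T where "T j = (+) (c j) ` ?S" for j
    have "compact ?S"
      using assms(1) by (simp add: closed_Int_compact)
    then have T_compact: "compact (T j)" for j
      unfolding T_def by (rule compact_translation)
    have T_sets: "T j \<in> sets lborel" for j
      using T_compact[of j] by (simp add: borel_compact)
    have S_sets: "?S \<in> sets borel"
      using \<open>compact ?S\<close> by (simp add: borel_compact)
    have S_finite: "emeasure lborel ?S \<noteq> \<top>"
      using emeasure_bounded_finite[of ?S] by (simp add: bounded_Int)
    have T_measure: "emeasure lborel (T j) = emeasure lborel ?S" for j
    proof -
      have T_vimage: "T j = (+) (- c j) -` ?S"
      proof
        show "T j \<subseteq> (+) (- c j) -` ?S"
          unfolding T_def by auto
        show "(+) (- c j) -` ?S \<subseteq> T j"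
          unfolding T_def by (force intro: image_eqI[where x = "- c j + z" for z])
      qed
      have "emeasure lborel ?S = emeasure (distr lborel borel ((+) (- c j))) ?S"
        by (simp add: lborel_distr_plus)
      also have "\<dots> = emeasure lborel (T j)"
        using S_sets by (subst emeasure_distr) (auto simp: T_vimage)
      finally show ?thesis by simp
    qed
    have "disjoint_family T"
    proof -
      have less: "T i \<inter> T j = {}" if "i < j" for i j
      proof (rule ccontr)
        assume "T i \<inter> T j \<noteq> {}"
        then obtain x y where xy: "x \<in> S" "y \<in> S" "c i + x = c j + y"
          unfolding T_def by auto
        have "y = x + (1 / real (Suc i) - 1 / real (Suc j)) *\<^sub>R b"
          using xy(3) by (simp add: c_def algebra_simps)
        moreover have "0 < 1 / real (Suc i) - 1 / real (Suc j)"
          using that by (simp add: divide_strict_left_mono)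
        ultimately show False
          using line[OF xy(1)] xy(2) by metis
      qed
      show ?thesis
        unfolding disjoint_family_on_def
        by (metis less Int_commute linorder_neqE_nat)
    qed
    then have "(\<Sum>j. emeasure lborel (T j)) = emeasure lborel (\<Union>j. T j)"
      using T_sets by (intro suminf_emeasure) auto
    also have "\<dots> \<le> emeasure lborel (cball (0 :: 'a) (real k + norm b))"
    proof (rule emeasure_mono)
      show "(\<Union>j. T j) \<subseteq> cball 0 (real k + norm b)"
      proof clarify
        fix j z assume "z \<in> T j"
        then obtain x where x: "z = c j + x" "norm x \<le> real k"
          unfolding T_def by auto
        have "norm (c j) \<le> norm b"
          using mult_right_mono[of "1 / real (Suc j)" 1 "norm b"] by (simp add: c_def)
        then show "z \<in> cball 0 (real k + norm b)"
          using norm_triangle_ineq[of "c j" x] x by simp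
      qed
    qed simp
    also have "\<dots> < \<infinity>"
      by (rule emeasure_bounded_finite) simp
    finally have "(\<Sum>j::nat. emeasure lborel ?S) < \<infinity>"
      by (simp add: T_measure)
    \<comment> \<open>A series of equal nonnegative terms has a finite sum only if the term is
      0.\<close>
    then have "emeasure lborel ?S = 0"
      using summable_suminf_not_top[of "\<lambda>_. measure lborel ?S"]
      by (simp add: emeasure_eq_ennreal_measure summable_const_iff S_finite)
    then show ?thesis
      using S_sets by auto
  qed
  have "(\<Union>k. S \<inter> cball 0 (real k)) \<in> null_sets lborel"
    by (intro null_sets_UN bounded_part)
  also have "(\<Union>k. S \<inter> cball 0 (real k)) = S"
    using real_arch_simple by auto
  finally show ?thesis .
qed

section \<open>Upper hemicontinuity of maximizers\<close>

text \<open>Each competitor \<open>c\<close> imposes a closed condition \<open>G c\<close> on pairs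
  in \<open>S \<times> C\<close>. Their intersection is closed, and projecting away the compact
  factor \<open>C\<close> is a closed map.\<close>

lemma closedin_maximizer_hits:
  fixes f :: "'p::topological_space \<times> 'a::topological_space \<Rightarrow> real"
  assumes "compact A" and f: "continuous_on (S \<times> A) f" and C: "closedin (top_of_set A) C"
  shows "closedin (top_of_set S) {p \<in> S. \<exists>a\<in>C. \<forall>c\<in>A. f (p, c) \<le> f (p, a)}"
proof (cases "A = {}")
  case True
  then show ?thesis using C by (auto simp: closedin_def)
next
  case False
  have "C \<subseteq> A"
    using C by (simp add: closedin_def)
  have "compact C"
    using \<open>compact A\<close> C by (metis closedin_compact_eq closedin_compact)
  define G where "G c = (S \<times> C) \<inter> (\<lambda>q. f q - f (fst q, c)) -` {0..}" for c
  have "closedin (top_of_set (S \<times> C)) (G c)" if "c \<in> A" for c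
  proof -
    have "continuous_on (S \<times> C) f"
      by (rule continuous_on_subset[OF f]) (use \<open>C \<subseteq> A\<close> in auto)
    moreover have "continuous_on (S \<times> C) (\<lambda>q. f (fst q, c))"
      by (rule continuous_on_compose2[OF f]) (use that in \<open>auto intro!: continuous_intros\<close>)
    ultimately show ?thesis
      unfolding G_def by (intro continuous_closedin_preimage continuous_on_diff closed_atLeast)
  qed
  then have "closedin (top_of_set (S \<times> C)) (\<Inter>c\<in>A. G c)"
    using False by (intro closedin_INT) auto
  moreover have "closed_map (prod_topology (top_of_set S) (top_of_set C)) (top_of_set S) fst"
    by (rule closed_map_fst) (simp add: \<open>compact C\<close> compact_space_subtopology)
  ultimately have "closedin (top_of_set S) (fst ` (\<Inter>c\<in>A. G c))"
    by (simp add: closed_map_def prod_topology_subtopology_eu flip: euclidean_product_topology)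
  also have "fst ` (\<Inter>c\<in>A. G c) = {p \<in> S. \<exists>a\<in>C. \<forall>c\<in>A. f (p, c) \<le> f (p, a)}"
    using False by (force simp: G_def image_iff)
  finally show ?thesis .
qed

text \<open>For open \<open>W\<close> around \<open>a\<close>, the parameters having a maximizer in
  \<open>A - W\<close> form a relatively closed set. By uniqueness it misses \<open>p\<close>, hence
  eventually misses \<open>ps j\<close>. Arguing with neighbourhoods avoids subsequences, which
  compactness alone need not supply.\<close>

lemma maximizers_tendsto:
  fixes f :: "'p::topological_space \<times> 'a::topological_space \<Rightarrow> real"
  assumes "compact A" and f: "continuous_on (S \<times> A) f"
    and ps: "\<And>j. ps j \<in> S" "ps \<longlonglongrightarrow> p" "p \<in> S"
    and as: "\<And>j. as j \<in> A" "\<And>j c. c \<in> A \<Longrightarrow> f (ps j, c) \<le> f (ps j, as j)"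
    and unique: "\<And>b. b \<in> A \<Longrightarrow> (\<And>c. c \<in> A \<Longrightarrow> f (p, c) \<le> f (p, b)) \<Longrightarrow> b = a"
  shows "as \<longlonglongrightarrow> a"
proof (rule topological_tendstoI)
  fix W assume "open W" "a \<in> W"
  let ?H = "{p \<in> S. \<exists>b\<in>A - W. \<forall>c\<in>A. f (p, c) \<le> f (p, b)}"
  have "closedin (top_of_set A) (A - W)"
    using \<open>open W\<close> by (simp add: Diff_eq closedin_closed_Int closed_Compl)
  then have "closedin (top_of_set S) ?H"
    by (rule closedin_maximizer_hits[OF \<open>compact A\<close> f])
  then obtain F where F: "closed F" "?H = S \<inter> F"
    unfolding closedin_closed by blast
  have "p \<notin> ?H"
    using unique \<open>a \<in> W\<close> by blast
  then have "p \<in> - F"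
    using F \<open>p \<in> S\<close> by blast
  then have "\<forall>\<^sub>F j in sequentially. ps j \<in> - F"
    using ps(2) F(1) by (intro topological_tendstoD) auto
  then show "\<forall>\<^sub>F j in sequentially. as j \<in> W"
  proof (rule eventually_mono)
    fix j assume "ps j \<in> - F"
    then have "ps j \<notin> ?H"
      using F by blast
    then show "as j \<in> W"
      using ps(1) as by blast
  qed
qed

section \<open>Negligibility of ties\<close>

lemma mem_best_response_iff:
  "a \<in> best_response UA A \<delta> x v \<longleftrightarrow>
    a \<in> A \<and> (\<forall>c\<in>A. UA (x, c) + v \<bullet> \<delta> c \<le> UA (x, a) + v \<bullet> \<delta> a)"
  by (auto simp: best_response_def is_arg_max_linorder)

lemma nonunique_best_response_null:
  fixes A :: "'a::topological_space set" and \<delta> :: "'a \<Rightarrow> real ^ 'n"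
  assumes "compact A" "A \<noteq> {}" and UA: "continuous_on A (\<lambda>a. UA (x, a))"
    and \<delta>: "continuous_on A \<delta>" and inj: "inj_on \<delta> A"
  shows "{v. \<not> is_singleton (best_response UA A \<delta> x v)} \<in> null_sets lborel"
proof -
  define B where "B = best_response UA A \<delta> x"
  \<comment> \<open>Both regions are cut out by closed conditions, so that closedness passes to
    \<open>H\<close>. Two thresholds are used because with \<open>q = r\<close> the regions could
    share an action, and the monotonicity argument would lose its strict gap.\<close>
  define L where "L i q = A \<inter> (\<lambda>a. \<delta> a $ i) -` {..q}" for i q
  define R where "R i r = A \<inter> (\<lambda>a. \<delta> a $ i) -` {r..}" for i r
  define H where "H C = {v. \<exists>a\<in>C. a \<in> B v}" for C
  have f: "continuous_on (UNIV \<times> A) (\<lambda>(v, a). UA (x, a) + v \<bullet> \<delta> a)"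
    unfolding split_def
    by (intro continuous_intros continuous_on_compose2[OF UA] continuous_on_compose2[OF \<delta>]) auto
  have H_closed: "closed (H C)" if "closedin (top_of_set A) C" for C
  proof -
    have "H C = {v \<in> UNIV. \<exists>a\<in>C. \<forall>c\<in>A. (\<lambda>(v, a). UA (x, a) + v \<bullet> \<delta> a) (v, c)
        \<le> (\<lambda>(v, a). UA (x, a) + v \<bullet> \<delta> a) (v, a)}"
      using closedin_subset[OF that] by (auto simp: H_def B_def mem_best_response_iff)
    then show ?thesis
      using closedin_maximizer_hits[OF \<open>compact A\<close> f that] by simp
  qed
  have \<delta>i: "continuous_on A (\<lambda>a. \<delta> a $ i)" for i
    by (intro continuous_intros \<delta>)
  have "closedin (top_of_set A) (L i q)" for i q
    unfolding L_def by (intro continuous_closedin_preimage \<delta>i closed_atMost)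
  moreover have "closedin (top_of_set A) (R i q)" for i q
    unfolding R_def by (intro continuous_closedin_preimage \<delta>i closed_atLeast)
  ultimately have closed: "closed (H (L i q) \<inter> H (R i r))" for i q r
    using H_closed by (intro closed_Int) auto
  have null: "H (L i q) \<inter> H (R i r) \<in> null_sets lborel" if "q < r" for i q r
  proof (rule closed_null_set_if_one_point_per_line[OF closed])
    fix v :: "real ^ 'n" and t :: real
    assume v: "v \<in> H (L i q) \<inter> H (R i r)" and "0 < t"
    show "v + t *\<^sub>R axis i 1 \<notin> H (L i q) \<inter> H (R i r)"
    proof
      assume "v + t *\<^sub>R axis i 1 \<in> H (L i q) \<inter> H (R i r)"
      then obtain a' where a': "a' \<in> B (v + t *\<^sub>R axis i 1)" "a' \<in> A" "\<delta> a' $ i \<le> q"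
        by (auto simp: H_def L_def)
      obtain a where a: "a \<in> B v" "a \<in> A" "r \<le> \<delta> a $ i"
        using v by (auto simp: H_def R_def)
      \<comment> \<open>Compare a maximizer at \<open>v\<close> from the high region with one at the
        shifted weight from the low region. Adding the two optimality inequalities cancels
        \<open>UA\<close>, leaving \<open>\<delta> a $ i \<le> \<delta> a' $ i\<close> against
        \<open>q < r\<close>.\<close>
      have "UA (x, a') + v \<bullet> \<delta> a' \<le> UA (x, a) + v \<bullet> \<delta> a"
        using a a' by (simp add: B_def mem_best_response_iff)
      moreover have "UA (x, a) + (v + t *\<^sub>R axis i 1) \<bullet> \<delta> a
          \<le> UA (x, a') + (v + t *\<^sub>R axis i 1) \<bullet> \<delta> a'"
        using a a' by (simp add: B_def mem_best_response_iff)
      ultimately have "t * \<delta> a $ i \<le> t * \<delta> a' $ i"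
        by (simp add: inner_add_left inner_axis')
      then show False
        using \<open>0 < t\<close> a a' that by simp
    qed
  qed
  \<comment> \<open>An empty set is not a singleton either; excluding it leaves two distinct
    maximizers.\<close>
  have nonempty: "B v \<noteq> {}" for v
  proof -
    have "continuous_on A (\<lambda>a. UA (x, a) + v \<bullet> \<delta> a)"
      by (intro continuous_intros UA \<delta>)
    then show ?thesis
      using continuous_attains_sup[OF \<open>compact A\<close> \<open>A \<noteq> {}\<close>]
      by (fastforce simp: B_def mem_best_response_iff)
  qed
  have separated: "\<exists>i. \<exists>q\<in>\<rat>. \<exists>r\<in>\<rat>. q < r \<and> v \<in> H (L i q) \<inter> H (R i r)"
    if v: "\<not> is_singleton (B v)" for v
  proof -
    have *: "\<exists>i. \<exists>q\<in>\<rat>. \<exists>r\<in>\<rat>. q < r \<and> v \<in> H (L i q) \<inter> H (R i r)"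
      if ab: "a \<in> B v" "b \<in> B v" "\<delta> a $ i < \<delta> b $ i" for a b i
    proof -
      obtain q where q: "q \<in> \<rat>" "\<delta> a $ i < q" "q < \<delta> b $ i"
        using Rats_dense_in_real[OF ab(3)] by blast
      obtain r where r: "r \<in> \<rat>" "q < r" "r < \<delta> b $ i"
        using Rats_dense_in_real[OF q(3)] by blast
      have "a \<in> A" "b \<in> A"
        using ab by (auto simp: B_def mem_best_response_iff)
      then have "v \<in> H (L i q) \<inter> H (R i r)"
        using ab q r by (auto simp: H_def L_def R_def intro!: less_imp_le)
      then show ?thesis
        using q r by blast
    qed
    obtain a b where ab: "a \<in> B v" "b \<in> B v" "a \<noteq> b"
      using v nonempty[of v] unfolding is_singleton_iff_ex1 by blast
    then have "a \<in> A" "b \<in> A"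
      by (auto simp: B_def mem_best_response_iff)
    then have "\<delta> a \<noteq> \<delta> b"
      using ab(3) inj by (auto dest: inj_onD)
    then obtain i where "\<delta> a $ i < \<delta> b $ i \<or> \<delta> b $ i < \<delta> a $ i"
      by (metis vec_eq_iff linorder_neqE)
    then show ?thesis
      using *[OF ab(1,2)] *[OF ab(2,1)] by blast
  qed
  \<comment> \<open>Lebesgue measure on Borel sets is not complete, so inclusion in a null set is
    not enough: this converse makes the set of ties equal to the countable union.\<close>
  have not_singleton: "\<not> is_singleton (B v)" if v: "v \<in> H (L i q) \<inter> H (R i r)" "q < r" for v i q r
  proof
    assume "is_singleton (B v)"
    then obtain a where "B v = {a}"
      by (auto simp: is_singleton_def)
    then show False
      using v by (auto simp: H_def L_def R_def)
  qed
  let ?I = "(UNIV :: 'n set) \<times> {(q, r). q \<in> \<rat> \<and> r \<in> \<rat> \<and> q < (r :: real)}"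
  have "{v. \<not> is_singleton (B v)} = (\<Union>(i, q, r)\<in>?I. H (L i q) \<inter> H (R i r))"
    using separated not_singleton by fastforce
  also have "\<dots> \<in> null_sets lborel"
  proof (rule null_sets_UN')
    have "countable (\<rat> \<times> \<rat> :: (real \<times> real) set)"
      by (simp add: countable_rat)
    then have "countable {(q, r). q \<in> \<rat> \<and> r \<in> \<rat> \<and> q < (r :: real)}"
      by (rule countable_subset[rotated]) auto
    then show "countable ?I"
      by (simp add: countable_finite)
  qed (use null in auto)
  finally show ?thesis
    by (simp add: B_def)
qed

section \<open>Almost sure convergence and continuity of the expected utility\<close>

theorem theorem3p4:
  fixes A :: "'a :: topological_space set"
    and UA UP :: "(real ^ 'm) \<times> 'a \<Rightarrow> real"
    and \<delta> :: "'a \<Rightarrow> real ^ 'n"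
    and M :: "'w measure"
    and w :: "'w \<Rightarrow> real ^ 'n"
  assumes "compact A" and "A \<noteq> {}"
    and "continuous_on (cbox 0 1 \<times> A) UA"
    and "continuous_on (cbox 0 1 \<times> A) UP"
    and "continuous_on A \<delta>" and "inj_on \<delta> A"
    and "prob_space M"
    and "w \<in> borel_measurable M"
    and "absolutely_continuous lborel (distr M borel w)"
  shows "(\<forall>x \<in> cbox 0 1. \<forall>xs. (\<forall>j. xs j \<in> cbox 0 1) \<and> xs \<longlonglongrightarrow> x \<longrightarrow>
            measure M {\<omega> \<in> space M.
              is_singleton (best_response UA A \<delta> x (w \<omega>)) \<and>
              (\<forall>as. (\<forall>j. as j \<in> best_response UA A \<delta> (xs j) (w \<omega>)) \<longrightarrow>
                as \<longlonglongrightarrow> the_elem (best_response UA A \<delta> x (w \<omega>)))} = 1)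
       \<and> continuous_on (cbox 0 1) (principal_utility M w UP UA A \<delta>)"
proof -
  interpret prob_space M by fact
  let ?X = "cbox 0 1 :: (real ^ 'm) set"
  define B where "B = best_response UA A \<delta>"
  define a where "a x v = the_elem (B x v)" for x v
  define D where "D x = {v. is_singleton (B x v)}" for x
  define E where "E x = {\<omega> \<in> space M. w \<omega> \<in> D x}" for x
  \<comment> \<open>The integrand as a function of the weight, set to 0 where the response is not
    unique.\<close>
  define F where "F x v = indicator (D x) v *\<^sub>R UP (x, a x v)" for x v
  note w [measurable] = \<open>w \<in> borel_measurable M\<close>
  have B_iff: "b \<in> B x v \<longleftrightarrow>
      b \<in> A \<and> (\<forall>c\<in>A. UA (x, c) + v \<bullet> \<delta> c \<le> UA (x, b) + v \<bullet> \<delta> b)" for b x v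
    by (simp add: B_def mem_best_response_iff)
  have a_mem: "a x v \<in> B x v" if "v \<in> D x" for x v
    using that unfolding a_def D_def by (metis is_singleton_the_elem mem_Collect_eq singletonI)
  have a_unique: "b = a x v" if "v \<in> D x" "b \<in> B x v" for b x v
    using that unfolding a_def D_def by (metis is_singleton_the_elem mem_Collect_eq singletonD)
  \<comment> \<open>Contract and weight vary jointly: a fixed weight serves both claims of the
    theorem, a fixed contract the measurability of \<open>F x\<close>.\<close>
  have convergence: "as \<longlonglongrightarrow> a x v"
    if "\<And>j. xs j \<in> ?X" "xs \<longlonglongrightarrow> x" "x \<in> ?X" "vs \<longlonglongrightarrow> v" "v \<in> D x" "\<And>j. as j \<in> B (xs j) (vs j)"
    for xs x vs v as
  proof (rule maximizers_tendsto[where S = "?X \<times> UNIV" and A = A and ps = "\<lambda>j. (xs j, vs j)"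
        and p = "(x, v)" and f = "\<lambda>((x, v), a). UA (x, a) + v \<bullet> \<delta> a"])
    show "continuous_on ((?X \<times> UNIV) \<times> A) (\<lambda>((x, v), a). UA (x, a) + v \<bullet> \<delta> a)"
      unfolding split_def
      by (intro continuous_intros continuous_on_compose2[OF assms(3)]
          continuous_on_compose2[OF assms(5)]) auto
    show "(\<lambda>j. (xs j, vs j)) \<longlonglongrightarrow> (x, v)"
      using that by (intro tendsto_Pair)
  qed (use that assms a_unique in \<open>auto simp: B_iff\<close>)
  have null: "- D x \<in> null_sets lborel" if "x \<in> ?X" for x
  proof -
    have "continuous_on A (\<lambda>a. UA (x, a))"
      by (rule continuous_on_compose2[OF assms(3)]) (use that in \<open>auto intro!: continuous_intros\<close>)
    then show ?thesis
      using nonunique_best_response_null[of A UA x \<delta>] assms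
      by (simp add: D_def B_def Collect_neg_eq)
  qed
  have D_sets: "D x \<in> sets borel" if "x \<in> ?X" for x
    using null[OF that] by (metis borel_comp double_complement null_setsD2 sets_lborel)
  have AE_D: "AE \<omega> in M. w \<omega> \<in> D x" if "x \<in> ?X" for x
  proof -
    have "- D x \<in> null_sets (distr M borel w)"
      using null[OF that] assms(9) by (auto simp: absolutely_continuous_def)
    then have "AE v in distr M borel w. v \<in> D x"
      using AE_not_in by fastforce
    then show ?thesis
      using D_sets[OF that] by (subst (asm) AE_distr_iff) auto
  qed
  have "measure M {\<omega> \<in> space M. is_singleton (B x (w \<omega>)) \<and>
      (\<forall>as. (\<forall>j. as j \<in> B (xs j) (w \<omega>)) \<longrightarrow> as \<longlonglongrightarrow> the_elem (B x (w \<omega>)))} = 1"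
    if x: "x \<in> ?X" and xs: "\<And>j. xs j \<in> ?X" "xs \<longlonglongrightarrow> x" for x xs
  proof -
    \<comment> \<open>Uniqueness at \<open>x\<close> already forces convergence of every selection,
      so the event reduces to \<open>E x\<close>, whose measurability is known.\<close>
    have "{\<omega> \<in> space M. is_singleton (B x (w \<omega>)) \<and>
        (\<forall>as. (\<forall>j. as j \<in> B (xs j) (w \<omega>)) \<longrightarrow> as \<longlonglongrightarrow> the_elem (B x (w \<omega>)))} = E x"
      using convergence[OF xs x tendsto_const] unfolding E_def D_def a_def by auto
    moreover have "E x \<in> sets M"
      using D_sets[OF x] unfolding E_def by measurable
    ultimately show ?thesis
      using AE_D[OF x] prob_eq_1 by (auto simp: E_def)
  qed
  moreover have "continuous_on ?X (principal_utility M w UP UA A \<delta>)"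
  proof -
    have pu: "principal_utility M w UP UA A \<delta> x = (LINT \<omega>|M. F x (w \<omega>))" for x
      unfolding principal_utility_def set_lebesgue_integral_def F_def
      by (intro Bochner_Integration.integral_cong)
        (auto simp: D_def B_def a_def indicator_def)
    \<comment> \<open>On the Borel set \<open>D x\<close> the unique response depends continuously
      on the weight; extension by 0 keeps the integrand measurable.\<close>
    have F_meas: "F x \<in> borel_measurable borel" if x: "x \<in> ?X" for x
      unfolding F_def
    proof (rule borel_measurable_continuous_on_indicator)
      show "D x \<in> sets borel"
        by (rule D_sets[OF x])
      have "(\<lambda>j. UP (x, a x (vs j))) \<longlonglongrightarrow> UP (x, a x v)"
        if vs: "\<And>j. vs j \<in> D x" "v \<in> D x" "vs \<longlonglongrightarrow> v" for vs v
      proof -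
        have "(\<lambda>j. a x (vs j)) \<longlonglongrightarrow> a x v"
          using x vs a_mem by (intro convergence[of "\<lambda>_. x"]) auto
        then have "(\<lambda>j. (x, a x (vs j))) \<longlonglongrightarrow> (x, a x v)"
          by (intro tendsto_intros)
        then show ?thesis
          using x vs a_mem by (intro continuous_on_tendsto_compose[OF assms(4)]) (auto simp: B_iff)
      qed
      then show "continuous_on (D x) (\<lambda>v. UP (x, a x v))"
        by (simp add: continuous_on_sequentially o_def)
    qed
    have "compact (UP ` (?X \<times> A))"
      using assms by (intro compact_continuous_image compact_Times) auto
    then obtain b where b: "\<And>x c. x \<in> ?X \<Longrightarrow> c \<in> A \<Longrightarrow> \<bar>UP (x, c)\<bar> \<le> b"
      using compact_imp_bounded[of "UP ` (?X \<times> A)"] unfolding bounded_iff by force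
    \<comment> \<open>This covers the weights where \<open>F\<close> takes its default value
      0.\<close>
    have "0 \<le> b"
      using b[of 0] \<open>A \<noteq> {}\<close> by (force simp: mem_box_cart)
    have F_bound: "norm (F x v) \<le> b" if "x \<in> ?X" for x v
      using that b a_mem[of v x] \<open>0 \<le> b\<close> by (auto simp: F_def indicator_def B_iff)
    have "(\<lambda>j. LINT \<omega>|M. F (xs j) (w \<omega>)) \<longlonglongrightarrow> (LINT \<omega>|M. F x (w \<omega>))"
      if x: "x \<in> ?X" and xs: "\<And>j. xs j \<in> ?X" "xs \<longlonglongrightarrow> x" for x xs
    proof (rule integral_dominated_convergence[where w = "\<lambda>_. b"])
      \<comment> \<open>Outside a countable union of null events, responses are unique along the
        whole sequence, so no \<open>F (xs j)\<close> falls back to its default.\<close>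
      have "AE \<omega> in M. \<forall>j. w \<omega> \<in> D (xs j)"
        using AE_D xs by (simp add: AE_all_countable)
      then show "AE \<omega> in M. (\<lambda>j. F (xs j) (w \<omega>)) \<longlonglongrightarrow> F x (w \<omega>)"
        using AE_D[OF x]
      proof eventually_elim
        case (elim \<omega>)
        then have "(\<lambda>j. a (xs j) (w \<omega>)) \<longlonglongrightarrow> a x (w \<omega>)"
          using xs x a_mem by (intro convergence[of xs x "\<lambda>_. w \<omega>"]) auto
        then have "(\<lambda>j. UP (xs j, a (xs j) (w \<omega>))) \<longlonglongrightarrow> UP (x, a x (w \<omega>))"
          using xs x elim a_mem
          by (intro continuous_on_tendsto_compose[OF assms(4)] tendsto_Pair) (auto simp: B_iff)
        then show ?case
          using elim by (simp add: F_def)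
      qed
    qed (use F_meas F_bound x xs in auto)
    then show ?thesis
      by (simp add: continuous_on_sequentially o_def pu)
  qed
  ultimately show ?thesis
    by (simp add: B_def)
qed

end
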